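(* For every word $v\in\{L,R\}^\star$, $\lim_{n\to\infty}P_{vRL^n}=\mu_v$ and $\lim_{n\to\infty}P_{vLR^n}=\hat\mu_v$. Additionally, $\lim_{n\to\infty}P_{L^n}=\mu_1$ and $\lim_{n\to\infty}P_{R^n}=\hat\mu_1$. Hence $$\{\mathcal{L}(X^w_\infty): w\in\{L,R\}^{\mathbb{N}}\text{ is eventually constant}\}=\{\mu_t: t\in 2\mathbb{N}+1\}\cup\{\hat\mu_t: t\in2\mathbb{N}+1\}.$$
   Context: $\mathbb{N}=\{0,1,2,\dots\}$. For $n\in\mathbb{N}$, $s(n)$ is the number of ones in the binary expansion of $n$. For $t\in\mathbb{N}$, $d\in\mathbb{Z}$, $\mu_t(d)=\lim_{N\to\infty}\frac1N|\{n<N: s(n+t)-s(n)=d\}|$; it is well known that the limit exists and $\mu_t$ is a probability measure on $\mathbb{Z}$ with mean zero. Its reflection is $\hat\mu_t(d)=\mu_t(-d)$. Limits of probability measures on $\mathbb{Z}$ are taken in the topology of pointwise convergence (equivalently, $\ell^1$ convergence when the limit is a probability measure). $\{L,R\}^\star$ is the set of finite words in $L,R$, including the empty word $\varepsilon$; $L^n$, $R^n$ are constant words of length $n$. On odd positive integers let $L(t)=2t-1$, $R(t)=2t+1$. A word $v=v_1\dots v_n$ is identified with the odd integer $v_n\circ\cdots\circ v_1(3)$ ($\varepsilon$ with $3$); this is a bijection from $\{L,R\}^\star$ onto the odd integers $\ge3$, and $\mu_v$ means $\mu_t$ for the corresponding $t$. Measures $P_v$: for probability measures $\mu,\nu$ on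 $\mathbb{Z}$ with mean zero, $\Phi(\mu,\nu)(d)=\frac12\mu(d+1)+\frac12\nu(d-1)$, $\Phi_L(\mu,\nu)=(\Phi(\mu,\nu),\nu)$, $\Phi_R(\mu,\nu)=(\mu,\Phi(\mu,\nu))$; $P_v=\Phi\circ\Phi_{v_n}\circ\cdots\circ\Phi_{v_1}(\delta_0,\delta_0)$, with $P_\varepsilon=\frac12\delta_{-1}+\frac12\delta_1$. The process $X^w_t$: trees are the elements of the smallest set containing $\bullet$ and closed under $(T_-,T_+)\mapsto[T_-,T_+]$. Put $T_\varepsilon=[\bullet,\bullet]$ and, if $T_v=[T_v^-,T_v^+]$, $T_{vL}=[T_v,T_v^+]$, $T_{vR}=[T_v^-,T_v]$. On $\Omega$, the space of sequences $\omega=(\omega_1,\omega_2,\dots)$ with $\omega_i\in\{-1,1\}$, with the product of the measures $\frac12\delta_{-1}+\frac12\delta_1$, let $\xi_i(\omega)=\omega_i$, $S_0=0$, $S_n=\xi_1+\cdots+\xi_n$. Set $\tau_\bullet=0$ and, for $T=[T_-,T_+]$, $\tau_T(\omega_1,\omega_2,\dots)=1+\tau_{T_-}(\omega_2,\omega_3,\dots)$ if $\omega_1=-1$, and $=1+\tau_{T_+}(\omega_2,\omega_3,\dots)$ if $\omega_1=1$. For $w=(w_1,w_2,\dots)\in\{L,R\}^{\mathbb{N}}$ and $t\ge0$, $X^w_t=S_{\tau}$ with $\tau=\tau_{T_{w_1\dots w_t}}$. The law of $X^w_t$ is $P_{w_1\dots w_t}$. For $w$ eventually constant, $X^w_t$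 is an $L^2$-bounded martingale, and $X^w_\infty$ denotes its almost sure limit $\lim_{t\to\infty}X^w_t$; $\mathcal{L}(X)$ is the law of $X$.
   Formalization: The second limit is corrected to the reflection of μ_{v̄}, where v̄ is v with L and R exchanged; the printed version fails for v=L, since P_{LLR^n}(-3)≥1/8 for all n while the reflection of μ_5 at -3 equals μ_5(3)=0. *)

theory Defs
  imports "HOL-Probability.Probability"
begin

text \<open>
  Measures on the integers are given by their mass functions of type \<open>int \<Rightarrow> real\<close>; the topology on
  this function type (from \<open>HOL-Analysis.Function_Topology\<close>) is that of pointwise convergence.
  The law of a random variable is a genuine measure (\<open>distr\<close>), and the measure with mass
  function \<open>f\<close> is \<open>mass_measure f\<close>.
\<close>

definition mass_measure :: "(int \<Rightarrow> real) \<Rightarrow> int measure" where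
  "mass_measure f = point_measure UNIV (\<lambda>d. ennreal (f d))"

definition refl_mass :: "(int \<Rightarrow> real) \<Rightarrow> int \<Rightarrow> real" where
  "refl_mass f d = f (- d)"

definition binary_ones :: "nat \<Rightarrow> nat" where
  "binary_ones n = card {i. bit n i}"

definition mu :: "nat \<Rightarrow> int \<Rightarrow> real" where
  "mu t d = lim (\<lambda>N. real (card {n. n < N \<and>
      int (binary_ones (n + t)) - int (binary_ones n) = d}) / real N)"


datatype letter = L | R

fun letter_odd :: "letter \<Rightarrow> nat \<Rightarrow> nat" where
  "letter_odd L t = 2 * t - 1"
| "letter_odd R t = 2 * t + 1"

text \<open>
  Words are read from the left: \<open>fold f [v\<^sub>1, \<dots>, v\<^sub>n] = f v\<^sub>n \<circ> \<dots> \<circ> f v\<^sub>1\<close>.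
\<close>

definition word_odd :: "letter list \<Rightarrow> nat" where
  "word_odd v = fold letter_odd v 3"

definition mu_word :: "letter list \<Rightarrow> int \<Rightarrow> real" where
  "mu_word v = mu (word_odd v)"


definition delta0 :: "int \<Rightarrow> real" where
  "delta0 d = (if d = 0 then 1 else 0)"

fun Phi :: "(int \<Rightarrow> real) \<times> (int \<Rightarrow> real) \<Rightarrow> int \<Rightarrow> real" where
  "Phi (\<mu>, \<nu>) = (\<lambda>d. 1/2 * \<mu> (d + 1) + 1/2 * \<nu> (d - 1))"

fun Phi_letter ::
  "letter \<Rightarrow> (int \<Rightarrow> real) \<times> (int \<Rightarrow> real) \<Rightarrow> (int \<Rightarrow> real) \<times> (int \<Rightarrow> real)" where
  "Phi_letter L (\<mu>, \<nu>) = (Phi (\<mu>, \<nu>), \<nu>)"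
| "Phi_letter R (\<mu>, \<nu>) = (\<mu>, Phi (\<mu>, \<nu>))"

definition P :: "letter list \<Rightarrow> int \<Rightarrow> real" where
  "P v = Phi (fold Phi_letter v (delta0, delta0))"

text \<open>
  Exchanging the two letters reflects \<open>P\<close>: the mass function of \<open>P (swap_word v)\<close> is the reflection of
  that of \<open>P v\<close>. So the limit along \<open>v L R\<^sup>n\<close> is the reflection of the limit along
  \<open>swap_word v R L\<^sup>n\<close>, and the two words \<open>v\<close> and \<open>swap_word v\<close> must not be confused: for
  \<open>v = L\<close>, \<open>P (L L R\<^sup>n) (-3) \<ge> 1/8\<close>, but \<open>mu_word v 3 = mu 5 3 = 0\<close>.
\<close>

fun swap_letter :: "letter \<Rightarrow> letter" where
  "swap_letter L = R"
| "swap_letter R = L"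

definition swap_word :: "letter list \<Rightarrow> letter list" where
  "swap_word v = map swap_letter v"


datatype tree = Bullet | Node tree tree

text \<open>
  Only trees of the form \<open>Node T\<^sub>- T\<^sub>+\<close> are ever extended, so the value at \<open>Bullet\<close> is irrelevant.
\<close>

fun extend :: "letter \<Rightarrow> tree \<Rightarrow> tree" where
  "extend L (Node Tm Tp) = Node (Node Tm Tp) Tp"
| "extend R (Node Tm Tp) = Node Tm (Node Tm Tp)"
| "extend _ Bullet = Bullet"

definition word_tree :: "letter list \<Rightarrow> tree" where
  "word_tree v = fold extend v (Node Bullet Bullet)"

text \<open>
  The underlying space of \<open>\<Omega>\<close> is \<open>streams {-1, 1}\<close>. Streams are indexed from 0, so
  \<open>\<omega>\<^sub>i\<close> is \<open>\<omega> !! (i - 1)\<close>.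
\<close>

definition \<Omega> :: "int stream measure" where
  "\<Omega> = stream_space (uniform_count_measure {-1, 1})"

definition S :: "nat \<Rightarrow> int stream \<Rightarrow> int" where
  "S n \<omega> = (\<Sum>i<n. \<omega> !! i)"

fun tau :: "tree \<Rightarrow> int stream \<Rightarrow> nat" where
  "tau Bullet \<omega> = 0"
| "tau (Node Tm Tp) \<omega> = 1 + (if shd \<omega> = -1 then tau Tm (stl \<omega>) else tau Tp (stl \<omega>))"

definition X :: "letter stream \<Rightarrow> nat \<Rightarrow> int stream \<Rightarrow> int" where
  "X w t \<omega> = S (tau (word_tree (stake t w)) \<omega>) \<omega>"

definition X_inf :: "letter stream \<Rightarrow> int stream \<Rightarrow> int" where
  "X_inf w \<omega> = lim (\<lambda>t. X w t \<omega>)"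

definition law :: "(int stream \<Rightarrow> int) \<Rightarrow> int measure" where
  "law Y = distr \<Omega> (count_space UNIV) Y"

definition eventually_constant :: "letter stream \<Rightarrow> bool" where
  "eventually_constant w \<longleftrightarrow> (\<exists>c. \<forall>\<^sub>F n in sequentially. w !! n = c)"

end

theory Submission
  imports Defs
begin

text \<open>
  The recursions \<open>\<mu>\<^sub>2\<^sub>k\<^sub>+\<^sub>1 = \<Phi>(\<mu>\<^sub>k\<^sub>+\<^sub>1, \<mu>\<^sub>k)\<close> and \<open>\<mu>\<^sub>2\<^sub>k = \<mu>\<^sub>k\<close> give
  \<open>\<mu>\<^sub>v = (\<Phi> \<circ> \<Phi>\<^sub>v)(\<mu>\<^sub>1, \<mu>\<^sub>1)\<close>, whereas \<open>P\<^sub>v = (\<Phi> \<circ> \<Phi>\<^sub>v)(\<delta>\<^sub>0, \<delta>\<^sub>0)\<close>. As \<open>\<Phi>\<close> commutes with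
  convolution, \<open>\<mu>\<^sub>v = \<mu>\<^sub>1 * P\<^sub>v\<close>, and this is the fixed point of the contraction
  \<open>f \<mapsto> \<Phi>(f, P\<^sub>v)\<close> whose iterates are the \<open>P\<^bsub>vRL^n\<^esub>\<close>; exchanging the letters reflects everything.
  The stopped walk \<open>X\<^sup>w\<^sub>t\<close> has law \<open>P\<close> of the prefix of \<open>w\<close>. When \<open>w\<close> is eventually constant, only one
  branch of the tree keeps growing, and the walk stabilises along every path that at some step
  leaves this branch, that is, almost surely; so the law of the limit is the limit of the laws.
\<close>

subsection \<open>Sum of digits\<close>

lemma finite_bits: "finite {i. bit (n :: nat) i}"
proof (rule finite_subset)
  show "{i. bit n i} \<subseteq> {..<n}"
  proof
    fix i assume "i \<in> {i. bit n i}"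
    then have "2 ^ i \<le> n"
      by (auto simp: bit_iff_odd intro: ccontr)
    then show "i \<in> {..<n}"
      by (metis lessThan_iff less_exp order_less_le_trans)
  qed
qed simp

lemma binary_ones_double: "binary_ones (2 * n) = binary_ones n"
proof -
  have "{i. bit (2 * n) i} = Suc ` {i. bit n i}"
    by (auto simp: bit_double_iff image_iff gr0_conv_Suc)
  then show ?thesis
    by (simp add: binary_ones_def card_image)
qed

lemma binary_ones_Suc_double: "binary_ones (Suc (2 * n)) = Suc (binary_ones n)"
proof -
  have "{i. bit (Suc (2 * n)) i} = insert 0 (Suc ` {i. bit n i})"
  proof (intro set_eqI)
    fix i show "i \<in> {i. bit (Suc (2 * n)) i} \<longleftrightarrow> i \<in> insert 0 (Suc ` {i. bit n i})"
      by (cases i) (auto simp: bit_Suc bit_0)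
  qed
  then show ?thesis
    by (simp add: binary_ones_def card_image finite_bits)
qed

text \<open>Adding 1 turns one zero into a one, and carries only erase ones. This bounds the support
  of \<open>mu 1\<close> from above, which starts the induction for t = 1.\<close>

lemma binary_ones_Suc_le: "binary_ones (Suc n) \<le> Suc (binary_ones n)"
proof (induction n rule: less_induct)
  case (less n)
  show ?case
  proof (cases "even n")
    case True
    then show ?thesis
      by (elim evenE) (simp add: binary_ones_double binary_ones_Suc_double)
  next
    case False
    then obtain m where n: "n = Suc (2 * m)" by (elim oddE) simp
    then have "binary_ones (Suc m) \<le> Suc (binary_ones m)"
      by (intro less) simp
    moreover have "Suc n = 2 * Suc m" using n by simp
    ultimately show ?thesis
      by (simp only: n binary_ones_double binary_ones_Suc_double)
  qed
qed

subsection \<open>The asymptotic densities\<close>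

text \<open>Counting below a finite N makes the digit recursions exact identities at even N, before
  any limit is taken.\<close>

definition diff_count :: "nat \<Rightarrow> int \<Rightarrow> nat \<Rightarrow> nat" where
  "diff_count t d N = card {n. n < N \<and> int (binary_ones (n + t)) - int (binary_ones n) = d}"

lemma diff_count_0: "diff_count t d 0 = 0"
  by (simp add: diff_count_def)

lemma diff_count_Suc:
  "diff_count t d (Suc N) =
     diff_count t d N + of_bool (int (binary_ones (N + t)) - int (binary_ones N) = d)"
proof -
  have "{n. n < Suc N \<and> int (binary_ones (n + t)) - int (binary_ones n) = d} =
      {n. n < N \<and> int (binary_ones (n + t)) - int (binary_ones n) = d} \<union>
      (if int (binary_ones (N + t)) - int (binary_ones N) = d then {N} else {})"
    by (auto simp: less_Suc_eq)
  then show ?thesis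
    by (simp add: diff_count_def)
qed

lemma diff_count_le: "diff_count t d N \<le> N"
  by (induction N) (auto simp: diff_count_0 diff_count_Suc of_bool_def)

lemma diff_count_zero_diff: "diff_count 0 d N = (if d = 0 then N else 0)"
  by (induction N) (auto simp: diff_count_0 diff_count_Suc)

lemma diff_count_zero_diff_LIMSEQ: "(\<lambda>N. real (diff_count 0 d N) / real N) \<longlonglongrightarrow> delta0 d"
  by (cases "d = 0")
    (auto simp: diff_count_zero_diff delta0_def intro!: tendsto_eventually eventually_sequentiallyI[of 1])

lemma diff_count_one_eq_0: "d \<ge> 2 \<Longrightarrow> diff_count 1 d N = 0"
proof (induction N)
  case (Suc N)
  then show ?case
    using binary_ones_Suc_le[of N] by (simp add: diff_count_Suc)
qed (simp add: diff_count_0)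

lemma diff_count_double: "diff_count (2 * t) d (2 * N) = 2 * diff_count t d N"
proof (induction N)
  case (Suc N)
  have eq: "2 * N + 2 * t = 2 * (N + t)" "Suc (2 * N) + 2 * t = Suc (2 * (N + t))"
    by simp_all
  have "diff_count (2 * t) d (2 * Suc N) = diff_count (2 * t) d (2 * N) +
      of_bool (int (binary_ones (2 * N + 2 * t)) - int (binary_ones (2 * N)) = d) +
      of_bool (int (binary_ones (Suc (2 * N) + 2 * t)) - int (binary_ones (Suc (2 * N))) = d)"
    by (simp only: diff_count_Suc mult_Suc_right add_2_eq_Suc add_Suc_right add_0_right)
  also have "\<dots> = 2 * diff_count t d (Suc N)"
    unfolding eq binary_ones_double binary_ones_Suc_double Suc diff_count_Suc
    by (auto simp: of_bool_def)
  finally show ?case .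
qed (simp add: diff_count_0)

text \<open>Split n by parity. For n = 2m the sum is 2(m + t) + 1 and gains a last digit one; for n
  = 2m + 1 it is 2(m + t + 1) and the last one of n is lost. Hence the shifts d - 1 and d +
  1.\<close>

lemma diff_count_Suc_double:
  "diff_count (2 * t + 1) d (2 * N) = diff_count t (d - 1) N + diff_count (t + 1) (d + 1) N"
proof (induction N)
  case (Suc N)
  have eq: "2 * N + (2 * t + 1) = Suc (2 * (N + t))"
      "Suc (2 * N) + (2 * t + 1) = 2 * (N + (t + 1))"
    by simp_all
  have "diff_count (2 * t + 1) d (2 * Suc N) = diff_count (2 * t + 1) d (2 * N) +
      of_bool (int (binary_ones (2 * N + (2 * t + 1))) - int (binary_ones (2 * N)) = d) +
      of_bool (int (binary_ones (Suc (2 * N) + (2 * t + 1))) - int (binary_ones (Suc (2 * N))) = d)"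
    by (simp only: diff_count_Suc mult_Suc_right add_2_eq_Suc add_Suc_right add_0_right)
  also have "\<dots> = diff_count t (d - 1) (Suc N) + diff_count (t + 1) (d + 1) (Suc N)"
    unfolding eq binary_ones_double binary_ones_Suc_double Suc diff_count_Suc
    by (auto simp: of_bool_def)
  finally show ?case .
qed (simp add: diff_count_0)

text \<open>The recursions control even indices only. As f(2N + 1) lies between f(2N) and f(2N) + 1,
  the averages at odd indices are squeezed to the same limit.\<close>

lemma LIMSEQ_average_even:
  fixes f :: "nat \<Rightarrow> nat"
  assumes le: "\<And>N. f N \<le> f (Suc N)" and Suc_le: "\<And>N. f (Suc N) \<le> Suc (f N)"
    and lim: "(\<lambda>N. real (f (2 * N)) / real (2 * N)) \<longlonglongrightarrow> l"
  shows "(\<lambda>N. real (f N) / real N) \<longlonglongrightarrow> l"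
proof (rule limseq_even_odd)
  let ?r = "\<lambda>N. real (2 * N) / real (2 * N + 1)"
  have inv: "(\<lambda>N. 1 / real (2 * N + 1)) \<longlonglongrightarrow> 0"
    using LIMSEQ_subseq_LIMSEQ[OF lim_1_over_n, of "\<lambda>N. 2 * N + 1"]
    by (simp add: strict_mono_def o_def)
  have "(\<lambda>N. 1 - 1 / real (2 * N + 1)) \<longlonglongrightarrow> 1 - 0"
    by (intro tendsto_diff tendsto_const inv)
  also have "(\<lambda>N. 1 - 1 / real (2 * N + 1)) = ?r"
    by (auto simp: field_simps)
  finally have r: "?r \<longlonglongrightarrow> 1"
    by simp
  have "(\<lambda>N. real (f (2 * N)) / real (2 * N) * ?r N) \<longlonglongrightarrow> l * 1"
    by (intro tendsto_mult lim r)
  then have low: "(\<lambda>N. real (f (2 * N)) / real (2 * N) * ?r N) \<longlonglongrightarrow> l"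
    by (simp only: mult_1_right)
  from tendsto_add[OF this inv]
  have up: "(\<lambda>N. real (f (2 * N)) / real (2 * N) * ?r N + 1 / real (2 * N + 1)) \<longlonglongrightarrow> l"
    by (simp only: add_0_right)
  show "(\<lambda>N. real (f (2 * N + 1)) / real (2 * N + 1)) \<longlonglongrightarrow> l"
  proof (rule tendsto_sandwich[OF _ _ low up])
    show "\<forall>\<^sub>F N in sequentially. real (f (2 * N)) / real (2 * N) * ?r N \<le> real (f (2 * N + 1)) / real (2 * N + 1)"
      using le by (intro eventually_sequentiallyI[of 1]) (simp add: divide_right_mono)
    show "\<forall>\<^sub>F N in sequentially. real (f (2 * N + 1)) / real (2 * N + 1) \<le>
        real (f (2 * N)) / real (2 * N) * ?r N + 1 / real (2 * N + 1)"
    proof (intro eventually_sequentiallyI[of 1])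
      fix N :: nat assume "1 \<le> N"
      have "real (f (2 * N + 1)) \<le> real (f (2 * N)) + 1"
        using Suc_le[of "2 * N"] by simp
      then show "real (f (2 * N + 1)) / real (2 * N + 1) \<le>
          real (f (2 * N)) / real (2 * N) * ?r N + 1 / real (2 * N + 1)"
        using \<open>1 \<le> N\<close> by (simp add: divide_right_mono flip: add_divide_distrib)
    qed
  qed
qed (use lim in simp)

lemma diff_count_LIMSEQ_even:
  assumes "(\<lambda>N. real (diff_count t d (2 * N)) / real (2 * N)) \<longlonglongrightarrow> l"
  shows "(\<lambda>N. real (diff_count t d N) / real N) \<longlonglongrightarrow> l"
  using assms by (rule LIMSEQ_average_even[rotated 2]) (auto simp: diff_count_Suc)

lemma diff_count_LIMSEQ_double:
  assumes "(\<lambda>N. real (diff_count t d N) / real N) \<longlonglongrightarrow> l"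
  shows "(\<lambda>N. real (diff_count (2 * t) d N) / real N) \<longlonglongrightarrow> l"
  using assms by (intro diff_count_LIMSEQ_even) (simp add: diff_count_double)

lemma diff_count_LIMSEQ_Suc_double:
  assumes "(\<lambda>N. real (diff_count t (d - 1) N) / real N) \<longlonglongrightarrow> l"
    and "(\<lambda>N. real (diff_count (t + 1) (d + 1) N) / real N) \<longlonglongrightarrow> l'"
  shows "(\<lambda>N. real (diff_count (2 * t + 1) d N) / real N) \<longlonglongrightarrow> 1/2 * l' + 1/2 * l"
proof (rule diff_count_LIMSEQ_even)
  have "(\<lambda>N. 1/2 * (real (diff_count (t + 1) (d + 1) N) / real N) +
      1/2 * (real (diff_count t (d - 1) N) / real N)) \<longlonglongrightarrow> 1/2 * l' + 1/2 * l"
    by (intro tendsto_intros assms)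
  then show "(\<lambda>N. real (diff_count (2 * t + 1) d (2 * N)) / real (2 * N)) \<longlonglongrightarrow> 1/2 * l' + 1/2 * l"
    unfolding diff_count_Suc_double by (simp add: add_divide_distrib add.commute)
qed

text \<open>For t = 1 the recursion refers back to t = 1, but at d + 1 instead of d. So the
  induction descends in d, from d = 2 where all counts vanish.\<close>

lemma diff_count_one_convergent: "convergent (\<lambda>N. real (diff_count 1 d N) / real N)"
proof (cases "d \<ge> 2")
  case True
  then show ?thesis
    by (simp add: diff_count_one_eq_0[simplified] convergent_const)
next
  case False
  then have "d \<le> 2" by simp
  then show ?thesis
  proof (induction d rule: int_le_induct)
    case base
    then show ?case by (simp add: diff_count_one_eq_0[simplified] convergent_const)
  next
    case (step d)
    note diff_count_zero_diff_LIMSEQ[of "d - 1 - 1"]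
    moreover obtain l where "(\<lambda>N. real (diff_count (0 + 1) (d - 1 + 1) N) / real N) \<longlonglongrightarrow> l"
      using step by (auto simp: convergent_def)
    ultimately have "(\<lambda>N. real (diff_count (2 * 0 + 1) (d - 1) N) / real N)
        \<longlonglongrightarrow> 1/2 * l + 1/2 * delta0 (d - 1 - 1)"
      by (rule diff_count_LIMSEQ_Suc_double)
    then show ?case
      by (auto simp: convergent_def)
  qed
qed

text \<open>For odd t = 2m + 1 > 1 both m and m + 1 are below t; t = 1 must be a base case because
  there m + 1 = t.\<close>

lemma diff_count_convergent: "convergent (\<lambda>N. real (diff_count t d N) / real N)"
proof (induction t arbitrary: d rule: less_induct)
  case (less t)
  show ?case
  proof (cases "t = 0 \<or> t = 1")
    case True
    then show ?thesis
      using diff_count_zero_diff_LIMSEQ diff_count_one_convergent by (auto simp: convergent_def)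
  next
    case gt: False
    show ?thesis
    proof (cases "even t")
      case True
      then obtain m where "t = 2 * m" by (elim evenE)
      then show ?thesis
        using gt less[of m d] diff_count_LIMSEQ_double[of m d] by (auto simp: convergent_def)
    next
      case False
      then obtain m where "t = 2 * m + 1" by (elim oddE)
      then show ?thesis
        using gt less[of m "d - 1"] less[of "m + 1" "d + 1"] diff_count_LIMSEQ_Suc_double[of m d]
        by (auto simp: convergent_def)
    qed
  qed
qed

section \<open>The densities \<open>mu t\<close> and their recursions\<close>

lemma mu_LIMSEQ: "(\<lambda>N. real (diff_count t d N) / real N) \<longlonglongrightarrow> mu t d"
  using diff_count_convergent[of t d]
  by (simp add: mu_def convergent_LIMSEQ_iff flip: diff_count_def)

lemma mu_nonneg: "0 \<le> mu t d"
  by (rule LIMSEQ_le_const[OF mu_LIMSEQ]) auto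

lemma mu_le_1: "mu t d \<le> 1"
  by (rule LIMSEQ_le_const2[OF mu_LIMSEQ]) (auto simp: divide_le_eq diff_count_le)

lemma mu_double: "mu (2 * t) = mu t"
  using diff_count_LIMSEQ_double[OF mu_LIMSEQ] mu_LIMSEQ
  by (intro ext) (blast intro: LIMSEQ_unique)

lemma mu_Suc_double: "mu (2 * t + 1) = Phi (mu (t + 1), mu t)"
proof
  show "mu (2 * t + 1) d = Phi (mu (t + 1), mu t) d" for d
    using diff_count_LIMSEQ_Suc_double[OF mu_LIMSEQ mu_LIMSEQ, of t d] mu_LIMSEQ[of "2 * t + 1" d]
    by (simp add: LIMSEQ_unique)
qed

lemma mu_zero: "mu 0 = delta0"
  using diff_count_zero_diff_LIMSEQ mu_LIMSEQ by (intro ext) (blast intro: LIMSEQ_unique)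

lemma mu_one: "mu 1 = Phi (mu 1, delta0)"
  using mu_Suc_double[of 0] by (simp add: mu_zero)

subsection \<open>Limits of the measures \<open>P\<^sub>v\<close>\<close>

lemma tendsto_fun_iff:
  fixes f :: "'a \<Rightarrow> 'i \<Rightarrow> 'b::topological_space"
  shows "(f \<longlongrightarrow> l) F \<longleftrightarrow> (\<forall>i. ((\<lambda>x. f x i) \<longlongrightarrow> l i) F)"
proof -
  have "(f \<longlongrightarrow> l) F \<longleftrightarrow> limitin (product_topology (\<lambda>_. euclidean) UNIV) f l F"
    by (simp only: euclidean_product_topology limitin_canonical_iff)
  then show ?thesis
    by (simp add: limitin_componentwise)
qed

text \<open>The recursion satisfied by \<open>\<mu>\<^sub>1 * \<nu>\<close>; it lets us avoid defining the convolution.\<close>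

definition conv_mu1 :: "(int \<Rightarrow> real) \<Rightarrow> (int \<Rightarrow> real) \<Rightarrow> bool" where
  "conv_mu1 \<nu> g \<longleftrightarrow> g = Phi (g, \<nu>)"

lemma conv_mu1_delta0: "conv_mu1 delta0 (mu 1)"
  unfolding conv_mu1_def by (rule mu_one)

text \<open>\<open>Phi\<close> is a combination of shifts and so commutes with convolution:
  expanding \<open>g\<close> at d + 1 and \<open>g'\<close> at d - 1 gives the same four terms as
  the right-hand side.\<close>

lemma conv_mu1_Phi:
  assumes "conv_mu1 \<nu> g" "conv_mu1 \<nu>' g'"
  shows "conv_mu1 (Phi (\<nu>, \<nu>')) (Phi (g, g'))"
proof -
  have "Phi (g, g') d = Phi (Phi (g, g'), Phi (\<nu>, \<nu>')) d" for d
  proof -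
    have "g (d + 1) = 1/2 * g (d + 2) + 1/2 * \<nu> d" "g' (d - 1) = 1/2 * g' d + 1/2 * \<nu>' (d - 2)"
      using fun_cong[OF assms(1)[unfolded conv_mu1_def], of "d + 1"]
        fun_cong[OF assms(2)[unfolded conv_mu1_def], of "d - 1"]
      by (simp_all add: algebra_simps)
    then show ?thesis by (simp add: add.commute add_divide_distrib)
  qed
  then show ?thesis
    unfolding conv_mu1_def by (rule ext)
qed

text \<open>The starting measure is a parameter because the same word acts on \<open>delta0\<close>,
  giving \<open>P v\<close>, and on \<open>mu 1\<close>, giving \<open>mu_word v\<close>.\<close>

definition pair_of :: "letter list \<Rightarrow> (int \<Rightarrow> real) \<Rightarrow> (int \<Rightarrow> real) \<times> (int \<Rightarrow> real)" where
  "pair_of v f = fold Phi_letter v (f, f)"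

lemma pair_of_snoc: "pair_of (v @ [c]) f = Phi_letter c (pair_of v f)"
  by (simp add: pair_of_def)

lemma P_eq_Phi_pair_of: "P v = Phi (pair_of v delta0)"
  by (simp add: P_def pair_of_def)

lemma word_odd_snoc: "word_odd (v @ [c]) = letter_odd c (word_odd v)"
  by (simp add: word_odd_def)

text \<open>
  For \<open>t = 2k + 1\<close> one has \<open>L t = 2 (2k) + 1\<close> and \<open>R t = 2 (2k + 1) + 1\<close>, so a letter
  replaces one of \<open>\<mu>\<^sub>k\<^sub>+\<^sub>1, \<mu>\<^sub>k\<close> by \<open>\<mu>\<^sub>t\<close>.
\<close>

lemma pair_of_mu1:
  obtains k where "1 \<le> k" "word_odd v = 2 * k + 1" "pair_of v (mu 1) = (mu (k + 1), mu k)"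
proof -
  have "\<exists>k\<ge>1. word_odd v = 2 * k + 1 \<and> pair_of v (mu 1) = (mu (k + 1), mu k)"
  proof (induction v rule: rev_induct)
    case Nil
    \<comment> \<open>The empty word codes 3, so k = 1, and the pair is constant because
      \<open>mu 2 = mu 1\<close>.\<close>
    then show ?case
      using mu_double[of 1] by (intro exI[of _ 1]) (simp add: word_odd_def pair_of_def numeral_2_eq_2)
  next
    case (snoc c v)
    then obtain k where k: "k \<ge> 1" "word_odd v = 2 * k + 1" "pair_of v (mu 1) = (mu (k + 1), mu k)"
      by blast
    show ?case
    proof (cases c)
      case L
      then show ?thesis
        using k mu_Suc_double[of k] mu_double[of k]
        by (intro exI[of _ "2 * k"]) (simp add: pair_of_snoc word_odd_snoc del: Phi.simps)
    next
      case R
      then show ?thesis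
        using k mu_Suc_double[of k] mu_double[of "k + 1"]
        by (intro exI[of _ "2 * k + 1"]) (simp add: pair_of_snoc word_odd_snoc del: Phi.simps)
    qed
  qed
  then show thesis using that by blast
qed

lemma odd_word_odd: "odd (word_odd v)"
  by (rule pair_of_mu1[of v]) simp

lemma mu_word_eq_Phi_pair_of: "mu_word v = Phi (pair_of v (mu 1))"
  by (rule pair_of_mu1[of v]) (simp only: mu_word_def mu_Suc_double)

text \<open>The relation holds for the starting measures, and every letter applies the same
  \<open>Phi\<close> on both sides.\<close>

lemma conv_mu1_pair_of:
  "conv_mu1 (fst (pair_of v delta0)) (fst (pair_of v (mu 1))) \<and>
   conv_mu1 (snd (pair_of v delta0)) (snd (pair_of v (mu 1)))"
proof (induction v rule: rev_induct)
  case Nil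
  show ?case using conv_mu1_delta0 by (simp add: pair_of_def)
next
  case (snoc c v)
  then show ?case
    by (cases c; cases "pair_of v delta0"; cases "pair_of v (mu 1)")
      (auto simp: pair_of_snoc conv_mu1_Phi simp del: Phi.simps)
qed

lemma conv_mu1_P: "conv_mu1 (P v) (mu_word v)"
  using conv_mu1_pair_of[of v] unfolding P_eq_Phi_pair_of mu_word_eq_Phi_pair_of
  by (cases "pair_of v delta0"; cases "pair_of v (mu 1)") (simp add: conv_mu1_Phi del: Phi.simps)

section \<open>Convergence to the fixed point\<close>

definition unit_valued :: "(int \<Rightarrow> real) \<Rightarrow> bool" where
  "unit_valued f \<longleftrightarrow> (\<forall>d. f d \<in> {0..1})"

lemma unit_valued_Phi: "unit_valued f \<Longrightarrow> unit_valued g \<Longrightarrow> unit_valued (Phi (f, g))"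
  unfolding unit_valued_def
proof
  fix d assume "\<forall>d. f d \<in> {0..1}" "\<forall>d. g d \<in> {0..1}"
  then have "f (d + 1) \<in> {0..1}" "g (d - 1) \<in> {0..1}" by blast+
  then show "Phi (f, g) d \<in> {0..1}" by simp
qed

lemma unit_valued_mu: "unit_valued (mu t)"
  by (simp add: unit_valued_def mu_nonneg mu_le_1)

lemma unit_valued_pair_of:
  "unit_valued f \<Longrightarrow> unit_valued (fst (pair_of v f)) \<and> unit_valued (snd (pair_of v f))"
proof (induction v rule: rev_induct)
  case Nil
  then show ?case by (simp add: pair_of_def)
next
  case (snoc c v)
  then show ?case
    by (cases c; cases "pair_of v f") (auto simp: pair_of_snoc unit_valued_Phi simp del: Phi.simps)
qed

lemma unit_valued_delta0: "unit_valued delta0"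
  by (simp add: unit_valued_def delta0_def)

text \<open>\<open>f \<mapsto> Phi (f, \<nu>)\<close> halves the supremum distance, so its iterates approach the fixed point \<open>g\<close>.\<close>

lemma LIMSEQ_Phi_iterates:
  assumes g: "conv_mu1 \<nu> g" "unit_valued g" and f0: "unit_valued (f 0)"
    and f: "\<And>n. f (Suc n) = Phi (f n, \<nu>)"
  shows "f \<longlonglongrightarrow> g"
  unfolding tendsto_fun_iff
proof
  fix d
  have bound: "\<bar>f n d - g d\<bar> \<le> (1/2) ^ n" for n d
  proof (induction n arbitrary: d)
    case 0
    have "f 0 d \<in> {0..1}" "g d \<in> {0..1}"
      using g f0 by (auto simp: unit_valued_def)
    then show ?case by auto
  next
    case (Suc n)
    have "g d = 1/2 * g (d + 1) + 1/2 * \<nu> (d - 1)"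
      using g by (auto simp: conv_mu1_def dest: fun_cong[of _ _ d])
    then have "f (Suc n) d - g d = (f n (d + 1) - g (d + 1)) / 2"
      by (simp add: f field_simps)
    then have "\<bar>f (Suc n) d - g d\<bar> = \<bar>f n (d + 1) - g (d + 1)\<bar> / 2"
      by (simp only: abs_divide abs_numeral)
    then show ?case using Suc[of "d + 1"] by simp
  qed
  have "(\<lambda>n. f n d - g d) \<longlonglongrightarrow> 0"
  proof (rule Lim_null_comparison)
    show "\<forall>\<^sub>F n in sequentially. norm (f n d - g d) \<le> (1/2) ^ n"
      using bound by simp
    show "(\<lambda>n. (1/2 :: real) ^ n) \<longlonglongrightarrow> 0"
      by (rule LIMSEQ_realpow_zero) auto
  qed
  then show "(\<lambda>n. f n d) \<longlonglongrightarrow> g d"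
    by (simp add: LIM_zero_iff)
qed

lemma pair_of_append_L:
  assumes "pair_of u f = (\<alpha>, \<nu>)"
  shows "pair_of (u @ replicate n L) f = (((\<lambda>h. Phi (h, \<nu>)) ^^ n) \<alpha>, \<nu>)"
proof (induction n)
  case (Suc n)
  have "u @ replicate (Suc n) L = (u @ replicate n L) @ [L]"
    by (simp add: replicate_append_same)
  then show ?case
    using Suc by (simp add: pair_of_snoc del: append_assoc Phi.simps)
qed (simp add: assms)

lemma P_append_L_LIMSEQ:
  assumes u: "pair_of u delta0 = (\<alpha>, \<nu>)" and g: "conv_mu1 \<nu> g" "unit_valued g"
  shows "(\<lambda>n. P (u @ replicate n L)) \<longlonglongrightarrow> g"
proof (rule LIMSEQ_Phi_iterates[OF g])
  \<comment> \<open>The outer \<open>Phi\<close> in \<open>P\<close> acts as one further letter L,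
    so the measures \<open>P (u @ replicate n L)\<close> are themselves successive iterates.\<close>
  have eq: "P (u @ replicate n L) = ((\<lambda>h. Phi (h, \<nu>)) ^^ Suc n) \<alpha>" for n
    by (simp add: P_eq_Phi_pair_of pair_of_append_L[OF u] del: Phi.simps)
  show "P (u @ replicate (Suc n) L) = Phi (P (u @ replicate n L), \<nu>)" for n
    unfolding eq by simp
  have "unit_valued \<alpha>" "unit_valued \<nu>"
    using unit_valued_pair_of[OF unit_valued_delta0, of u] u by auto
  then show "unit_valued (P (u @ replicate 0 L))"
    using u by (simp add: P_eq_Phi_pair_of unit_valued_Phi del: Phi.simps)
qed

lemma P_L_LIMSEQ: "(\<lambda>n. P (replicate n L)) \<longlonglongrightarrow> mu 1"
  using P_append_L_LIMSEQ[of "[]"] conv_mu1_delta0 unit_valued_mu by (simp add: pair_of_def)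

text \<open>The letter R stores \<open>P v\<close> in the second component, which the following
  letters L leave fixed; by \<open>conv_mu1_P\<close> the fixed point is then
  \<open>mu_word v\<close>.\<close>

lemma P_RL_LIMSEQ: "(\<lambda>n. P (v @ [R] @ replicate n L)) \<longlonglongrightarrow> mu_word v"
proof -
  have "pair_of (v @ [R]) delta0 = (fst (pair_of v delta0), P v)"
    by (cases "pair_of v delta0") (simp add: pair_of_snoc P_eq_Phi_pair_of)
  then show ?thesis
    using P_append_L_LIMSEQ[of "v @ [R]"] conv_mu1_P unit_valued_mu
    by (simp add: mu_word_def)
qed

section \<open>Reflection and the exchange of letters\<close>

lemma refl_mass_Phi: "refl_mass (Phi (f, g)) = Phi (refl_mass g, refl_mass f)"
  by (simp add: refl_mass_def fun_eq_iff algebra_simps)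

text \<open>Reflection interchanges the shifts by 1 and -1, hence the two arguments of
  \<open>Phi\<close>; so the components of the pair change places and L acts as R.\<close>

lemma pair_of_swap_word:
  "pair_of (swap_word v) delta0 = map_prod refl_mass refl_mass (prod.swap (pair_of v delta0))"
proof (induction v rule: rev_induct)
  case Nil
  then show ?case by (simp add: pair_of_def swap_word_def refl_mass_def delta0_def fun_eq_iff)
next
  case (snoc c v)
  have "swap_word (v @ [c]) = swap_word v @ [swap_letter c]"
    by (simp add: swap_word_def)
  then show ?case
    using snoc by (cases c; cases "pair_of v delta0") (auto simp: pair_of_snoc refl_mass_Phi simp del: Phi.simps)
qed

lemma P_swap_word: "P (swap_word v) = refl_mass (P v)"
  by (cases "pair_of v delta0")
    (simp add: P_eq_Phi_pair_of pair_of_swap_word refl_mass_Phi del: Phi.simps)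

lemma swap_letter_involution: "swap_letter (swap_letter c) = c"
  by (cases c) auto

lemma swap_word_involution: "swap_word (swap_word v) = v"
  by (simp add: swap_word_def o_def swap_letter_involution)

lemma refl_mass_LIMSEQ: "f \<longlonglongrightarrow> g \<Longrightarrow> (\<lambda>n. refl_mass (f n)) \<longlonglongrightarrow> refl_mass g"
  by (simp add: tendsto_fun_iff refl_mass_def)

lemma P_R_LIMSEQ: "(\<lambda>n. P (replicate n R)) \<longlonglongrightarrow> refl_mass (mu 1)"
  using refl_mass_LIMSEQ[OF P_L_LIMSEQ] by (simp add: swap_word_def flip: P_swap_word)

lemma P_LR_LIMSEQ: "(\<lambda>n. P (v @ [L] @ replicate n R)) \<longlonglongrightarrow> refl_mass (mu_word (swap_word v))"
proof -
  have "swap_word (swap_word v @ [R] @ replicate n L) = v @ [L] @ replicate n R" for n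
    using swap_word_involution[of v] by (simp add: swap_word_def)
  then show ?thesis
    using refl_mass_LIMSEQ[OF P_RL_LIMSEQ[of "swap_word v"]] by (simp only: flip: P_swap_word)
qed

text \<open>Undo the last letter: t = 2m + 1 is L(m + 1) if m is even and R(m) if m is odd.
  Whichever argument is odd is again at least 3 and smaller than t, unless t = 3.\<close>

lemma ex_word_odd:
  assumes "odd t" "3 \<le> t"
  obtains v where "word_odd v = t"
proof -
  have "\<exists>v. word_odd v = t"
    using assms
  proof (induction t rule: less_induct)
    case (less t)
    then obtain m where t: "t = 2 * m + 1" by (elim oddE)
    show ?case
    proof (cases "m = 1")
      case True
      then show ?thesis
        using t by (intro exI[of _ "[]"]) (simp add: word_odd_def)
    next
      case False
      show ?thesis
      proof (cases "even m")
        case True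
        then obtain v where "word_odd v = m + 1"
          using less.IH[of "m + 1"] less.prems t False by auto
        then show ?thesis
          using t by (intro exI[of _ "v @ [L]"]) (simp add: word_odd_snoc)
      next
        case odd: False
        then have "3 \<le> m" using False by (cases m; cases "m - 1"; cases "m - 2"; auto)
        then obtain v where "word_odd v = m"
          using less.IH[of m] odd t by auto
        then show ?thesis
          using t by (intro exI[of _ "v @ [R]"]) (simp add: word_odd_snoc)
      qed
    qed
  qed
  then show thesis using that by blast
qed

subsection \<open>The stopped random walk\<close>

lemma prob_space_coin: "prob_space (uniform_count_measure {-1, 1 :: int})"
  by (rule prob_space_uniform_count_measure) auto

interpretation coin: prob_space "uniform_count_measure {-1, 1 :: int}"
  by (rule prob_space_coin)

interpretation omega: prob_space \<Omega>
  unfolding \<Omega>_def by (rule coin.prob_space_stream_space)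

lemma space_Omega: "space \<Omega> = streams {-1, 1}"
  by (simp add: \<Omega>_def space_stream_space space_uniform_count_measure)

lemma measurable_stl_Omega [measurable]: "stl \<in> \<Omega> \<rightarrow>\<^sub>M \<Omega>"
  unfolding \<Omega>_def by (rule measurable_stl)

lemma measurable_shd_Omega [measurable]: "shd \<in> \<Omega> \<rightarrow>\<^sub>M count_space UNIV"
proof (rule measurable_compose[of shd _ "uniform_count_measure {-1, 1}" "\<lambda>x. x"])
  show "shd \<in> \<Omega> \<rightarrow>\<^sub>M uniform_count_measure {-1, 1}"
    unfolding \<Omega>_def by (rule measurable_shd)
  show "(\<lambda>x. x) \<in> uniform_count_measure {-1, 1} \<rightarrow>\<^sub>M count_space UNIV"
    by (auto simp: measurable_def space_uniform_count_measure sets_uniform_count_measure)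
qed

text \<open>Condition on the first toss. In its real-valued form this yields both the recursion for
  stopped laws and the nullity of constant paths.\<close>

lemma emeasure_Omega_split:
  assumes A: "A \<in> sets \<Omega>"
  shows "emeasure \<Omega> A =
    ennreal (1/2) * emeasure \<Omega> {\<omega> \<in> space \<Omega>. (-1) ## \<omega> \<in> A} +
    ennreal (1/2) * emeasure \<Omega> {\<omega> \<in> space \<Omega>. 1 ## \<omega> \<in> A}"
proof -
  have "emeasure \<Omega> A =
      (\<integral>\<^sup>+t. emeasure \<Omega> {\<omega> \<in> space \<Omega>. t ## \<omega> \<in> A} \<partial>uniform_count_measure {-1, 1})"
    using A unfolding \<Omega>_def by (rule coin.emeasure_stream_space)
  also have "\<dots> = ennreal (1/2) * emeasure \<Omega> {\<omega> \<in> space \<Omega>. (-1) ## \<omega> \<in> A} +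
      ennreal (1/2) * emeasure \<Omega> {\<omega> \<in> space \<Omega>. 1 ## \<omega> \<in> A}"
    by (simp add: uniform_count_measure_def nn_integral_point_measure_finite)
  finally show ?thesis .
qed

lemma measure_Omega_split:
  assumes A: "A \<in> sets \<Omega>"
  shows "measure \<Omega> A = 1/2 * measure \<Omega> {\<omega> \<in> space \<Omega>. (-1) ## \<omega> \<in> A} +
    1/2 * measure \<Omega> {\<omega> \<in> space \<Omega>. 1 ## \<omega> \<in> A}"
proof -
  let ?m = "\<lambda>c. measure \<Omega> {\<omega> \<in> space \<Omega>. c ## \<omega> \<in> A}"
  have "ennreal (measure \<Omega> A) = ennreal (1/2) * ennreal (?m (-1)) + ennreal (1/2) * ennreal (?m 1)"
    using emeasure_Omega_split[OF A] by (simp only: omega.emeasure_eq_measure)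
  also have "\<dots> = ennreal (1/2 * ?m (-1)) + ennreal (1/2 * ?m 1)"
    by (intro arg_cong2[where f = "(+)"] ennreal_mult[symmetric]) auto
  also have "\<dots> = ennreal (1/2 * ?m (-1) + 1/2 * ?m 1)"
    by (rule ennreal_plus[symmetric]) auto
  finally show ?thesis
    by (subst (asm) ennreal_inj) auto
qed

text \<open>Stated for arbitrary trees, since the first toss leads to subtrees that need not belong
  to any word.\<close>

definition stopped :: "tree \<Rightarrow> int stream \<Rightarrow> int" where
  "stopped T \<omega> = S (tau T \<omega>) \<omega>"

lemma stopped_Bullet: "stopped Bullet \<omega> = 0"
  by (simp add: stopped_def S_def)

lemma stopped_Node:
  "stopped (Node A B) \<omega> = shd \<omega> + (if shd \<omega> = -1 then stopped A (stl \<omega>) else stopped B (stl \<omega>))"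
  by (simp add: stopped_def S_def sum.lessThan_Suc_shift del: sum.lessThan_Suc)

lemma measurable_stopped [measurable]: "stopped T \<in> \<Omega> \<rightarrow>\<^sub>M count_space UNIV"
proof (induction T)
  case Bullet
  then show ?case by (simp add: stopped_Bullet cong: measurable_cong)
next
  case (Node A B)
  note [measurable] = Node
  show ?case
    unfolding stopped_Node[abs_def] by measurable
qed

definition stopped_mass :: "tree \<Rightarrow> int \<Rightarrow> real" where
  "stopped_mass T d = measure \<Omega> {\<omega> \<in> space \<Omega>. stopped T \<omega> = d}"

lemma stopped_mass_Bullet: "stopped_mass Bullet = delta0"
  using omega.prob_space by (auto simp: stopped_mass_def delta0_def stopped_Bullet fun_eq_iff)

text \<open>First-step analysis: to end at d, the walk after a toss -1 must gain d + 1 on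
  \<open>A\<close>, and after a toss 1 it must gain d - 1 on \<open>B\<close>.\<close>

lemma stopped_mass_Node: "stopped_mass (Node A B) = Phi (stopped_mass A, stopped_mass B)"
proof
  fix d
  have Stream: "c ## \<omega> \<in> space \<Omega> \<longleftrightarrow> \<omega> \<in> space \<Omega>" if "c = -1 \<or> c = 1" for c :: int and \<omega>
    using that by (auto simp: space_Omega streams_Stream)
  have "measure \<Omega> {\<omega> \<in> space \<Omega>. stopped (Node A B) \<omega> = d} =
      1/2 * measure \<Omega> {\<omega> \<in> space \<Omega>. stopped A \<omega> = d + 1} +
      1/2 * measure \<Omega> {\<omega> \<in> space \<Omega>. stopped B \<omega> = d - 1}"
    by (subst measure_Omega_split) (auto simp: Stream stopped_Node algebra_simps cong: conj_cong
        intro!: arg_cong2[where f = "(+)"] arg_cong[where f = "measure \<Omega>"])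
  then show "stopped_mass (Node A B) d = Phi (stopped_mass A, stopped_mass B) d"
    by (simp add: stopped_mass_def)
qed

lemma word_tree_snoc: "word_tree (v @ [c]) = extend c (word_tree v)"
  by (simp add: word_tree_def)

text \<open>\<open>extend\<close> replaces one subtree by the whole tree, just as
  \<open>Phi_letter\<close> replaces one measure by \<open>Phi\<close> of both. Keeping track of
  both subtrees carries the induction.\<close>

lemma word_tree_pair_of:
  obtains A B where "word_tree v = Node A B" "pair_of v delta0 = (stopped_mass A, stopped_mass B)"
proof -
  have "\<exists>A B. word_tree v = Node A B \<and> pair_of v delta0 = (stopped_mass A, stopped_mass B)"
  proof (induction v rule: rev_induct)
    case Nil
    then show ?case by (simp add: word_tree_def pair_of_def stopped_mass_Bullet)
  next
    case (snoc c v)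
    then show ?case
      by (cases c) (auto simp: word_tree_snoc pair_of_snoc stopped_mass_Node simp del: Phi.simps)
  qed
  then show thesis using that by blast
qed

lemma stopped_mass_word_tree: "stopped_mass (word_tree v) = P v"
  by (rule word_tree_pair_of[of v]) (simp add: P_eq_Phi_pair_of stopped_mass_Node del: Phi.simps)

lemma X_eq_stopped: "X w t = stopped (word_tree (stake t w))"
  by (simp add: X_def stopped_def fun_eq_iff)

lemma prob_X: "omega.prob {\<omega> \<in> space \<Omega>. X w t \<omega> = d} = P (stake t w) d"
  by (simp add: X_eq_stopped flip: stopped_mass_word_tree stopped_mass_def)

lemma measurable_X [measurable]: "X w t \<in> \<Omega> \<rightarrow>\<^sub>M count_space UNIV"
  by (simp add: X_eq_stopped measurable_stopped)

subsection \<open>Almost sure convergence\<close>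

text \<open>A path is constantly c iff its first toss is c and its tail is constantly c, so the
  probability p of this event satisfies p = p/2.\<close>

lemma AE_ex_snth_neq:
  assumes c: "c = -1 \<or> c = 1"
  shows "AE \<omega> in \<Omega>. \<exists>k. \<omega> !! k \<noteq> c"
proof -
  let ?A = "{\<omega> \<in> space \<Omega>. \<forall>k. \<omega> !! k = c}"
  have snth: "(\<lambda>\<omega>. \<omega> !! k) \<in> \<Omega> \<rightarrow>\<^sub>M count_space UNIV" for k
  proof (induction k)
    case (Suc k)
    then show ?case
      using measurable_compose[OF measurable_stl_Omega Suc] by simp
  qed (simp add: measurable_shd_Omega)
  note [measurable] = snth
  have A: "?A \<in> sets \<Omega>" by measurable
  have "(c' ## \<omega> \<in> ?A) \<longleftrightarrow> c' = c \<and> \<omega> \<in> ?A" if "c' = -1 \<or> c' = 1" for c' \<omega>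
    using that c by (auto simp: space_Omega streams_Stream Stream_snth split: nat.splits)
  then have "measure \<Omega> ?A = 1/2 * measure \<Omega> {\<omega> \<in> space \<Omega>. -1 = c \<and> \<omega> \<in> ?A} +
      1/2 * measure \<Omega> {\<omega> \<in> space \<Omega>. 1 = c \<and> \<omega> \<in> ?A}"
    using measure_Omega_split[OF A] by simp
  moreover have "measure \<Omega> {\<omega> \<in> space \<Omega>. Q \<and> \<omega> \<in> ?A} = (if Q then measure \<Omega> ?A else 0)" for Q
    by (cases Q) (auto intro!: arg_cong[where f = "measure \<Omega>"])
  ultimately have "measure \<Omega> ?A =
      1/2 * (if -1 = c then measure \<Omega> ?A else 0) + 1/2 * (if 1 = c then measure \<Omega> ?A else 0)"
    by (simp only:)
  with c have "measure \<Omega> ?A = 0"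
    by (elim disjE) simp_all
  then have "?A \<in> null_sets \<Omega>"
    using A by (simp add: null_sets_def omega.emeasure_eq_measure)
  then show ?thesis
    by (rule AE_I') auto
qed

lemma funpow_extend_L_Suc:
  "(extend L ^^ Suc n) (Node A B) = Node ((extend L ^^ n) (Node A B)) B"
  by (induction n) auto

lemma funpow_extend_R_Suc:
  "(extend R ^^ Suc n) (Node A B) = Node A ((extend R ^^ n) (Node A B))"
  by (induction n) auto

text \<open>Tosses of -1 follow the growing branch; the first other toss enters a copy of the fixed
  subtree \<open>B\<close>, and further extensions do not affect the path.\<close>

lemma stopped_funpow_extend_L:
  assumes "\<omega> !! k \<noteq> -1"
  shows "\<exists>l. \<forall>\<^sub>F n in sequentially. stopped ((extend L ^^ n) (Node A B)) \<omega> = l"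
  using assms
proof (induction k arbitrary: \<omega>)
  case 0
  then have "stopped ((extend L ^^ Suc n) (Node A B)) \<omega> = shd \<omega> + stopped B (stl \<omega>)" for n
    by (simp add: funpow_extend_L_Suc stopped_Node del: funpow.simps)
  \<comment> \<open>The unfolding covers positive exponents only, hence the index shift in the
    eventual statement.\<close>
  then show ?case
    by (subst eventually_sequentially_Suc[symmetric]) auto
next
  case (Suc k)
  then obtain l where
    "\<forall>\<^sub>F n in sequentially. stopped ((extend L ^^ n) (Node A B)) (stl \<omega>) = l"
    by auto
  then have "\<forall>\<^sub>F n in sequentially. stopped ((extend L ^^ Suc n) (Node A B)) \<omega> =
      shd \<omega> + (if shd \<omega> = -1 then l else stopped B (stl \<omega>))"
    by eventually_elim (simp add: funpow_extend_L_Suc stopped_Node del: funpow.simps)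
  then show ?case
    by (subst (asm) eventually_sequentially_Suc) blast
qed

text \<open>Mirror image: now the branch of tosses 1 grows, and a toss -1 leads into the fixed
  subtree \<open>A\<close>.\<close>

lemma stopped_funpow_extend_R:
  assumes "\<omega> !! k = -1"
  shows "\<exists>l. \<forall>\<^sub>F n in sequentially. stopped ((extend R ^^ n) (Node A B)) \<omega> = l"
  using assms
proof (induction k arbitrary: \<omega>)
  case 0
  then have "stopped ((extend R ^^ Suc n) (Node A B)) \<omega> = shd \<omega> + stopped A (stl \<omega>)" for n
    by (simp add: funpow_extend_R_Suc stopped_Node del: funpow.simps)
  then show ?case
    by (subst eventually_sequentially_Suc[symmetric]) auto
next
  case (Suc k)
  then obtain l where
    "\<forall>\<^sub>F n in sequentially. stopped ((extend R ^^ n) (Node A B)) (stl \<omega>) = l"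
    by auto
  then have "\<forall>\<^sub>F n in sequentially. stopped ((extend R ^^ Suc n) (Node A B)) \<omega> =
      shd \<omega> + (if shd \<omega> = -1 then stopped A (stl \<omega>) else l)"
    by eventually_elim (simp add: funpow_extend_R_Suc stopped_Node del: funpow.simps)
  then show ?case
    by (subst (asm) eventually_sequentially_Suc) blast
qed

lemma AE_convergent_X:
  assumes "w = u @- sconst c"
  shows "AE \<omega> in \<Omega>. \<exists>l. \<forall>\<^sub>F t in sequentially. X w t \<omega> = l"
proof -
  obtain A B where AB: "word_tree u = Node A B"
    by (rule word_tree_pair_of)
  have "word_tree (u @ replicate n c) = (extend c ^^ n) (Node A B)" for n
  proof -
    have "fold extend (replicate n c) T = (extend c ^^ n) T" for T
      by (induction n arbitrary: T) (auto simp: funpow_swap1)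
    then show ?thesis
      using AB by (simp add: word_tree_def)
  qed
  moreover have "stake (n + length u) w = u @ replicate n c" for n
    by (simp add: assms stake_shift map_replicate_const)
  ultimately have X: "X w (n + length u) \<omega> = stopped ((extend c ^^ n) (Node A B)) \<omega>" for n \<omega>
    by (simp only: X_eq_stopped)
  \<comment> \<open>The excluded value is the toss that stays on the growing branch.\<close>
  have "AE \<omega> in \<Omega>. \<exists>k. \<omega> !! k \<noteq> (case c of L \<Rightarrow> -1 | R \<Rightarrow> 1)"
    by (rule AE_ex_snth_neq) (cases c; simp)
  then show ?thesis
    using AE_space
  proof eventually_elim
    case (elim \<omega>)
    then obtain k where k: "\<omega> !! k \<noteq> (case c of L \<Rightarrow> -1 | R \<Rightarrow> 1)" by blast
    \<comment> \<open>Needed for c = R: a toss different from 1 has to be -1.\<close>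
    have "\<omega> !! k \<in> {-1, 1}"
      using elim by (intro snth_in) (simp add: space_Omega)
    with k have "\<exists>l. \<forall>\<^sub>F n in sequentially. stopped ((extend c ^^ n) (Node A B)) \<omega> = l"
      using stopped_funpow_extend_L[of \<omega> k A B] stopped_funpow_extend_R[of \<omega> k A B]
      by (cases c) auto
    then show ?case
      unfolding X[symmetric] by (subst (asm) eventually_sequentially_seg)
  qed
qed

section \<open>The limit variable and its law\<close>

lemma lim_eventually_const_int:
  fixes f :: "nat \<Rightarrow> int"
  shows "(\<forall>\<^sub>F t in sequentially. f t = l) \<Longrightarrow> lim f = l"
  by (intro limI tendsto_eventually)

text \<open>Off the convergence set \<open>X_inf\<close> takes the junk value \<open>THE l. False\<close>.\<close>

lemma X_inf_cases:
  "X_inf w \<omega> = d \<longleftrightarrow> (\<forall>\<^sub>F t in sequentially. X w t \<omega> = d) \<or>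
     (\<forall>l. \<not> (\<forall>\<^sub>F t in sequentially. X w t \<omega> = l)) \<and> d = (THE l. False)"
proof (cases "\<exists>l. \<forall>\<^sub>F t in sequentially. X w t \<omega> = l")
  case True
  then obtain l where l: "\<forall>\<^sub>F t in sequentially. X w t \<omega> = l" by blast
  then have "X_inf w \<omega> = l"
    unfolding X_inf_def by (rule lim_eventually_const_int)
  moreover have "d = l" if "\<forall>\<^sub>F t in sequentially. X w t \<omega> = d"
    using lim_eventually_const_int[OF l] lim_eventually_const_int[OF that] by simp
  ultimately show ?thesis using l by auto
next
  case False
  then have "\<not> (\<lambda>t. X w t \<omega>) \<longlonglongrightarrow> l" for l
    by (simp add: tendsto_discrete)
  then have "X_inf w \<omega> = (THE l. False)"
    by (simp add: X_inf_def lim_def Lim_def)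
  then show ?thesis using False by auto
qed

text \<open>By \<open>X_inf_cases\<close> each fibre is built from events about \<open>X w t\<close>
  with quantifiers over integers and naturals only; fibres suffice as the target is
  countable.\<close>

lemma measurable_X_inf [measurable]: "X_inf w \<in> \<Omega> \<rightarrow>\<^sub>M count_space UNIV"
proof -
  have "{\<omega> \<in> space \<Omega>. X_inf w \<omega> = d} \<in> sets \<Omega>" for d
    unfolding X_inf_cases eventually_sequentially by measurable
  moreover have "X_inf w -` {d} \<inter> space \<Omega> = {\<omega> \<in> space \<Omega>. X_inf w \<omega> = d}" for d
    by auto
  ultimately show ?thesis
    by (simp add: measurable_count_space_eq2_countable)
qed

text \<open>Stabilisation makes the indicators converge almost surely, and dominated convergence
  with bound 1 passes to probabilities; no martingale theorem enters.\<close>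

lemma prob_X_LIMSEQ:
  assumes "AE \<omega> in \<Omega>. \<exists>l. \<forall>\<^sub>F t in sequentially. X w t \<omega> = l"
  shows "(\<lambda>t. omega.prob {\<omega> \<in> space \<Omega>. X w t \<omega> = d}) \<longlonglongrightarrow>
    omega.prob {\<omega> \<in> space \<Omega>. X_inf w \<omega> = d}"
proof -
  have "(\<lambda>t. \<integral>\<omega>. indicator {\<omega> \<in> space \<Omega>. X w t \<omega> = d} \<omega> \<partial>\<Omega>) \<longlonglongrightarrow>
    (\<integral>\<omega>. indicator {\<omega> \<in> space \<Omega>. X_inf w \<omega> = d} \<omega> \<partial>\<Omega> :: real)"
  proof (rule integral_dominated_convergence[where w = "\<lambda>_. 1"])
    show "AE \<omega> in \<Omega>. (\<lambda>t. indicator {\<omega> \<in> space \<Omega>. X w t \<omega> = d} \<omega>) \<longlonglongrightarrow>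
        (indicator {\<omega> \<in> space \<Omega>. X_inf w \<omega> = d} \<omega> :: real)"
      using assms
    proof eventually_elim
      case (elim \<omega>)
      then obtain l where l: "\<forall>\<^sub>F t in sequentially. X w t \<omega> = l" by blast
      then have "X_inf w \<omega> = l"
        unfolding X_inf_def by (rule lim_eventually_const_int)
      with l show ?case
        by (intro tendsto_eventually) (auto elim!: eventually_mono simp: indicator_def)
    qed
  qed (auto simp: indicator_def)
  then show ?thesis by simp
qed

lemma sets_mass_measure: "sets (mass_measure f) = UNIV"
  by (simp add: mass_measure_def sets_point_measure)

lemma emeasure_mass_measure_singleton: "emeasure (mass_measure f) {d} = ennreal (f d)"
  by (simp add: mass_measure_def emeasure_point_measure_finite2)

text \<open>At each d, both masses are limits of \<open>P (stake t w) d\<close>, and singletons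
  determine a measure on the integers.\<close>

lemma law_X_inf_eq:
  assumes w: "w = u @- sconst c" and lim: "(\<lambda>n. P (u @ replicate n c)) \<longlonglongrightarrow> f"
  shows "law (X_inf w) = mass_measure f"
proof (rule measure_eqI_countable[of _ UNIV])
  fix d
  have "stake (n + length u) w = u @ replicate n c" for n
    by (simp add: w stake_shift map_replicate_const)
  with lim have "(\<lambda>n. P (stake (n + length u) w) d) \<longlonglongrightarrow> f d"
    by (simp add: tendsto_fun_iff)
  then have "(\<lambda>t. P (stake t w) d) \<longlonglongrightarrow> f d"
    by (rule LIMSEQ_offset)
  moreover have "(\<lambda>t. P (stake t w) d) \<longlonglongrightarrow> omega.prob {\<omega> \<in> space \<Omega>. X_inf w \<omega> = d}"
    using prob_X_LIMSEQ[OF AE_convergent_X[OF w]] by (simp add: prob_X)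
  ultimately have "omega.prob {\<omega> \<in> space \<Omega>. X_inf w \<omega> = d} = f d"
    by (rule LIMSEQ_unique[symmetric])
  moreover have "X_inf w -` {d} \<inter> space \<Omega> = {\<omega> \<in> space \<Omega>. X_inf w \<omega> = d}"
    by auto
  ultimately show "emeasure (law (X_inf w)) {d} = emeasure (mass_measure f) {d}"
    by (simp add: law_def emeasure_distr emeasure_mass_measure_singleton omega.emeasure_eq_measure)
qed (auto simp: law_def sets_mass_measure)

section \<open>Limit laws for eventually constant sequences\<close>

lemma law_X_inf_sconst_L: "law (X_inf (sconst L)) = mass_measure (mu 1)"
  using law_X_inf_eq[of _ "[]"] P_L_LIMSEQ by simp

lemma law_X_inf_sconst_R: "law (X_inf (sconst R)) = mass_measure (refl_mass (mu 1))"
  using law_X_inf_eq[of _ "[]"] P_R_LIMSEQ by simp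

lemma law_X_inf_RL: "law (X_inf ((v @ [R]) @- sconst L)) = mass_measure (mu_word v)"
  using P_RL_LIMSEQ[of v] by (intro law_X_inf_eq[OF refl]) simp

lemma law_X_inf_LR:
  "law (X_inf ((v @ [L]) @- sconst R)) = mass_measure (refl_mass (mu_word (swap_word v)))"
  using P_LR_LIMSEQ[of v] by (intro law_X_inf_eq[OF refl]) simp

lemma eventually_constant_shift: "eventually_constant (u @- sconst c)"
  unfolding eventually_constant_def
proof (intro exI eventually_sequentiallyI)
  fix n assume "length u \<le> n"
  then show "(u @- sconst c) !! n = c"
    by (simp add: shift_snth_ge)
qed

text \<open>Normal form: let the constant tail absorb all final letters c of the prefix. What
  remains is empty or ends in the other letter, matching the four limits above.\<close>

lemma eventually_constant_cases:
  assumes "eventually_constant w"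
  obtains c where "w = sconst c"
  | v c where "w = (v @ [swap_letter c]) @- sconst c"
proof -
  obtain c N where N: "\<And>n. n \<ge> N \<Longrightarrow> w !! n = c"
    using assms by (auto simp: eventually_constant_def eventually_sequentially)
  have "sdrop N w = sconst c"
    using N by (auto simp: sconst_alt sset_range sdrop_snth)
  then have "w = stake N w @- sconst c"
    using stake_sdrop[of N w] by simp
  moreover have "u @- sconst c = sconst c \<or>
      (\<exists>v. u @- sconst c = (v @ [swap_letter c]) @- sconst c)" for u
  proof (induction u rule: rev_induct)
    case (snoc a u)
    show ?case
    proof (cases "a = c")
      case True
      then have "(u @ [a]) @- sconst c = u @- sconst c"
        using shift_replicate_sconst[of 1 c] by (simp del: shift_replicate_sconst)
      with snoc show ?thesis by (simp only:)
    next
      case False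
      then have "a = swap_letter c" by (cases a; cases c) auto
      then show ?thesis by blast
    qed
  qed simp
  ultimately show thesis using that by metis
qed

theorem theorem21:
  shows "(\<forall>v. (\<lambda>n. P (v @ [R] @ replicate n L)) \<longlonglongrightarrow> mu_word v)
       \<and> (\<forall>v. (\<lambda>n. P (v @ [L] @ replicate n R)) \<longlonglongrightarrow> refl_mass (mu_word (swap_word v)))
       \<and> (\<lambda>n. P (replicate n L)) \<longlonglongrightarrow> mu 1
       \<and> (\<lambda>n. P (replicate n R)) \<longlonglongrightarrow> refl_mass (mu 1)
       \<and> {law (X_inf w) | w. eventually_constant w}
           = {mass_measure (mu t) | t. odd t} \<union> {mass_measure (refl_mass (mu t)) | t. odd t}"
proof (intro conjI allI P_RL_LIMSEQ P_LR_LIMSEQ P_L_LIMSEQ P_R_LIMSEQ set_eqI iffI)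
  fix M
  assume "M \<in> {law (X_inf w) | w. eventually_constant w}"
  then obtain w where M: "M = law (X_inf w)" and w: "eventually_constant w" by blast
  have "odd (1 :: nat)" by simp
  from w show "M \<in> {mass_measure (mu t) | t. odd t} \<union> {mass_measure (refl_mass (mu t)) | t. odd t}"
  proof (cases rule: eventually_constant_cases)
    case (1 c)
    then show ?thesis
      using M law_X_inf_sconst_L law_X_inf_sconst_R \<open>odd (1 :: nat)\<close> by (cases c) blast+
  next
    case (2 v c)
    then show ?thesis
      using M law_X_inf_RL[of v] law_X_inf_LR[of v] odd_word_odd
      unfolding mu_word_def by (cases c) fastforce+
  qed
next
  fix M
  assume "M \<in> {mass_measure (mu t) | t. odd t} \<union> {mass_measure (refl_mass (mu t)) | t. odd t}"
  then obtain t where t: "odd t" "M = mass_measure (mu t) \<or> M = mass_measure (refl_mass (mu t))"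
    by blast
  have const: "eventually_constant (sconst c)" for c
    using eventually_constant_shift[of "[]" c] by simp
  show "M \<in> {law (X_inf w) | w. eventually_constant w}"
  proof (cases "t = 1")
    \<comment> \<open>Words code only odd integers from 3 on, so t = 1 comes from the constant
      sequences.\<close>
    case True
    with t(2) have "M = law (X_inf (sconst L)) \<or> M = law (X_inf (sconst R))"
      by (simp add: law_X_inf_sconst_L law_X_inf_sconst_R)
    then show ?thesis
      using const by blast
  next
    case False
    with t(1) have "3 \<le> t" by (cases t; cases "t - 1"; cases "t - 2"; auto)
    with t(1) obtain v where v: "word_odd v = t" by (rule ex_word_odd)
    \<comment> \<open>The reflected measure uses the prefix \<open>swap_word v\<close>, so that the
      exchange in \<open>law_X_inf_LR\<close> brings back \<open>v\<close>.\<close>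
    with t(2) have "M = law (X_inf ((v @ [R]) @- sconst L)) \<or>
        M = law (X_inf ((swap_word v @ [L]) @- sconst R))"
      by (simp only: law_X_inf_RL law_X_inf_LR mu_word_def swap_word_involution)
    then show ?thesis
      using eventually_constant_shift by blast
  qed
qed

end
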